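(* Let $G$ be a graph of order $n$ with $\alpha(G)\leq 3$. Then the independence polynomial $I(G^{*};x)$ is unimodal, and it has a mode $k$ satisfying \[ \left\lfloor \frac{n+1}{2}\right\rfloor \leq k\leq \left\lfloor \frac{n+1}{2}\right\rfloor +1. \] In particular, if $\alpha(G)=2$ and $n$ is odd, or if $\alpha(G)=1$, then $I(G^{*};x)$ has mode $k=\left\lfloor \frac{n+1}{2}\right\rfloor$.
   Context: All graphs are simple (finite, undirected, no loops or multiple edges). A stable set is a set of pairwise non-adjacent vertices; $\alpha(G)$ is the maximum size of a stable set in $G$. If $s_k$ denotes the number of stable sets of cardinality $k$ in $G$, the independence polynomial is $I(G;x)=\sum_{k=0}^{\alpha(G)} s_k x^k$. A sequence $a_0,\dots,a_n$ is unimodal if there is an index $k$ (called a mode) with $a_0\leq a_1\leq\cdots\leq a_k\geq a_{k+1}\geq\cdots\geq a_n$; a polynomial is unimodal if its coefficient sequence is, and its mode is the mode of that sequence. For a graph $G$ with vertex set $\{v_1,\dots,v_n\}$, $G^{*}$ is the graph obtained by adding $n$ new vertices $u_1,\dots,u_n$ and the edges $u_iv_i$ ($1\le i\le n$), i.e. appending a single pendant edge to each vertex of $G$. *)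

theory Defs
  imports
    "Graph_Theory.Pair_Digraph"
    "HOL-Computational_Algebra.Polynomial"
begin

text \<open>
  Finite simple graphs are modelled by the locale \<open>pair_graph\<close>: finitely many vertices and a
  symmetric, loopless set of arcs between them, so that every undirected edge \<open>uv\<close> is represented
  by the two arcs \<open>(u, v)\<close> and \<open>(v, u)\<close>. The graph without vertices is allowed.
\<close>

definition stable_set :: "'a pair_pre_digraph \<Rightarrow> 'a set \<Rightarrow> bool" where
  "stable_set G S \<longleftrightarrow> S \<subseteq> pverts G \<and> (\<forall>u\<in>S. \<forall>v\<in>S. (u, v) \<notin> parcs G)"

definition stability_number :: "'a pair_pre_digraph \<Rightarrow> nat" where
  "stability_number G = Max {card S | S. stable_set G S}"

definition num_stable_sets :: "'a pair_pre_digraph \<Rightarrow> nat \<Rightarrow> nat" where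
  "num_stable_sets G k = card {S. stable_set G S \<and> card S = k}"

definition independence_poly :: "'a pair_pre_digraph \<Rightarrow> int poly" where
  "independence_poly G =
     (\<Sum>k = 0..stability_number G. monom (int (num_stable_sets G k)) k)"

text \<open>A mode \<open>k\<close> of the finite sequence \<open>a 0, \<dots>, a n\<close>; it need not be unique.\<close>

definition is_mode :: "(nat \<Rightarrow> 'b::linorder) \<Rightarrow> nat \<Rightarrow> nat \<Rightarrow> bool" where
  "is_mode a n k \<longleftrightarrow>
     k \<le> n \<and> (\<forall>i<k. a i \<le> a (Suc i)) \<and> (\<forall>i\<in>{k..<n}. a i \<ge> a (Suc i))"

definition unimodal :: "(nat \<Rightarrow> 'b::linorder) \<Rightarrow> nat \<Rightarrow> bool" where
  "unimodal a n \<longleftrightarrow> (\<exists>k. is_mode a n k)"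

definition poly_mode :: "'b::{zero,linorder} poly \<Rightarrow> nat \<Rightarrow> bool" where
  "poly_mode p k \<longleftrightarrow> is_mode (coeff p) (degree p) k"

definition unimodal_poly :: "'b::{zero,linorder} poly \<Rightarrow> bool" where
  "unimodal_poly p \<longleftrightarrow> unimodal (coeff p) (degree p)"

text \<open>
  The graph \<open>G\<^sup>*\<close>: \<open>Inl v\<close> is the vertex \<open>v\<close> of \<open>G\<close>, and \<open>Inr v\<close> is the new pendant vertex
  attached to it.
\<close>

definition pendant_graph :: "'a pair_pre_digraph \<Rightarrow> ('a + 'a) pair_pre_digraph" where
  "pendant_graph G =
     \<lparr> pverts = Inl ` pverts G \<union> Inr ` pverts G,
       parcs = {(Inl u, Inl v) | u v. (u, v) \<in> parcs G}
             \<union> {(Inl v, Inr v) | v. v \<in> pverts G}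
             \<union> {(Inr v, Inl v) | v. v \<in> pverts G} \<rparr>"

lemma pair_graph_pendant_graph:
  assumes "pair_graph G"
  shows "pair_graph (pendant_graph G)"
proof -
  interpret pair_graph G by fact
  have fin: "finite (pverts (pendant_graph G))"
    by (simp add: pendant_graph_def pair_finite_verts)
  have arcs: "fst e \<in> pverts (pendant_graph G) \<and> snd e \<in> pverts (pendant_graph G) \<and> fst e \<noteq> snd e"
    if "e \<in> parcs (pendant_graph G)" for e
    using that by (auto simp: pendant_graph_def dest: wellformed' no_loops')
  then have "parcs (pendant_graph G) \<subseteq> pverts (pendant_graph G) \<times> pverts (pendant_graph G)"
    by (auto simp: mem_Times_iff)
  with fin have "finite (parcs (pendant_graph G))"
    by (meson finite_SigmaI finite_subset)
  moreover have "sym (parcs (pendant_graph G))"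
    unfolding sym_def by (auto simp: pendant_graph_def intro: arcs_symmetric)
  ultimately show ?thesis
    using fin arcs by unfold_locales (auto simp: symmetric_def)
qed

end

theory Submission
  imports Defs
begin

text \<open>
  A stable set of \<open>G\<^sup>*\<close> with \<open>k\<close> elements consists of a stable set \<open>A\<close> of \<open>G\<close> together with all
  pendant vertices attached outside \<open>A\<close>, except for \<open>n - k\<close> of them. Hence the \<open>k\<close>-th coefficient
  of \<open>I(G\<^sup>*; x)\<close> is the sum over all stable sets \<open>A\<close> of \<open>n - card A choose (n - k)\<close>. As a function
  of \<open>k\<close> each summand is unimodal and symmetric about \<open>(n + card A) / 2\<close>, so the summands all
  increase up to \<open>(n + 1) div 2\<close>, and, because \<open>card A \<le> 3\<close>, all decrease from \<open>(n + 1) div 2 + 1\<close>.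
\<close>

section \<open>Growth of binomial coefficients in the lower index\<close>

text \<open>The ratio of the two coefficients is \<open>(N - q) / (q + 1)\<close>, which is at least
  1 under the hypothesis; the proof clears denominators and cancels \<open>Suc q\<close>.\<close>

lemma binomial_le_Suc:
  assumes "2 * q + 1 \<le> N"
  shows "N choose q \<le> N choose Suc q"
proof -
  have "Suc q * (N choose q) \<le> (N - q) * (N choose q)"
    using assms by (intro mult_right_mono) auto
  also have "\<dots> = Suc q * (N choose Suc q)"
    by (metis binomial_absorb_comp binomial_absorption)
  finally show ?thesis
    by (simp only: mult_le_cancel1)
qed

lemma binomial_Suc_le:
  assumes "N \<le> 2 * q + 1"
  shows "N choose Suc q \<le> N choose q"
proof -
  have "Suc q * (N choose Suc q) = (N - q) * (N choose q)"
    by (metis binomial_absorb_comp binomial_absorption)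
  also have "\<dots> \<le> Suc q * (N choose q)"
    using assms by (intro mult_right_mono) auto
  finally show ?thesis
    by (simp only: mult_le_cancel1)
qed

section \<open>Stable sets and the independence polynomial of a general graph\<close>

lemma stable_set_subset: "stable_set G S \<Longrightarrow> S \<subseteq> pverts G"
  by (simp add: stable_set_def)

lemma finite_stable_sets:
  assumes "finite (pverts G)"
  shows "finite {S. stable_set G S}"
  by (rule finite_subset[of _ "Pow (pverts G)"]) (auto simp: stable_set_def assms)

lemma card_le_stability_number:
  assumes "finite (pverts G)" "stable_set G S"
  shows "card S \<le> stability_number G"
  unfolding stability_number_def
  using finite_stable_sets[OF assms(1)] assms(2) by (intro Max_ge) auto

lemma stability_number_attained:
  assumes "finite (pverts G)"
  obtains S where "stable_set G S" "card S = stability_number G"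
proof -
  have "stable_set G {}"
    by (simp add: stable_set_def)
  then have "stability_number G \<in> {card S | S. stable_set G S}"
    unfolding stability_number_def
    using finite_stable_sets[OF assms] by (intro Max_in) auto
  then show ?thesis
    using that by auto
qed

lemma coeff_independence_poly:
  assumes "k \<le> stability_number G"
  shows "coeff (independence_poly G) k = int (num_stable_sets G k)"
  using assms by (simp add: independence_poly_def coeff_sum)

text \<open>A stable set of maximum size exists, so the top coefficient is nonzero. Since
  \<open>poly_mode\<close> refers to \<open>degree\<close>, this fixes the range of indices to be
  compared.\<close>

lemma degree_independence_poly:
  assumes "finite (pverts G)"
  shows "degree (independence_poly G) = stability_number G"
proof (rule antisym)
  show "degree (independence_poly G) \<le> stability_number G"
    by (auto simp: independence_poly_def coeff_sum intro!: degree_le)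
  obtain S where "stable_set G S" "card S = stability_number G"
    using stability_number_attained[OF assms] .
  moreover have "finite {S. stable_set G S \<and> card S = stability_number G}"
    using finite_stable_sets[OF assms] by simp
  ultimately have "num_stable_sets G (stability_number G) \<noteq> 0"
    by (auto simp: num_stable_sets_def)
  then show "stability_number G \<le> degree (independence_poly G)"
    by (intro le_degree) (simp add: coeff_independence_poly)
qed

section \<open>Stable sets of the pendant graph\<close>

lemma stable_set_pendant_graph:
  "stable_set (pendant_graph G) (Inl ` A \<union> Inr ` B) \<longleftrightarrow>
     stable_set G A \<and> B \<subseteq> pverts G \<and> A \<inter> B = {}"
  by (auto simp: stable_set_def pendant_graph_def ball_Un image_subset_iff)

text \<open>Splits a set of vertices of the pendant graph into original and pendant ones. As a
  left-to-right rewrite rule it would loop, so simplification below uses it reversed.\<close>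

lemma Inl_Inr_vimage: "S = Inl ` (Inl -` S) \<union> Inr ` (Inr -` S)"
proof (intro set_eqI)
  show "x \<in> S \<longleftrightarrow> x \<in> Inl ` (Inl -` S) \<union> Inr ` (Inr -` S)" for x
    by (cases x) auto
qed

lemma vimage_Inl_Inr:
  "Inl -` (Inl ` A \<union> Inr ` B) = A" "Inr -` (Inl ` A \<union> Inr ` B) = B"
  by auto

lemma card_Inl_Inr:
  assumes "finite A" "finite B"
  shows "card (Inl ` A \<union> Inr ` B) = card A + card B"
  using assms by (subst card_Un_disjoint) (auto simp: card_image)

text \<open>At most one of \<open>Inl v\<close> and \<open>Inr v\<close> is chosen for each
  \<open>v\<close>, so both halves of a stable set project to disjoint subsets of
  \<open>pverts G\<close>; the set of all pendant vertices attains the bound.\<close>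

lemma stability_number_pendant_graph:
  assumes "finite (pverts G)"
  shows "stability_number (pendant_graph G) = card (pverts G)"
proof (rule antisym)
  have fin: "finite (pverts (pendant_graph G))"
    using assms by (simp add: pendant_graph_def)
  show "card (pverts G) \<le> stability_number (pendant_graph G)"
  proof -
    have "stable_set (pendant_graph G) (Inl ` {} \<union> Inr ` pverts G)"
      unfolding stable_set_pendant_graph by (simp add: stable_set_def)
    then show ?thesis
      using card_le_stability_number[OF fin] by (fastforce simp: card_image)
  qed
  obtain S where S: "stable_set (pendant_graph G) S"
    "card S = stability_number (pendant_graph G)"
    using stability_number_attained[OF fin] .
  define A where "A = Inl -` S"
  define B where "B = Inr -` S"
  have S_eq: "S = Inl ` A \<union> Inr ` B"
    unfolding A_def B_def by (rule Inl_Inr_vimage)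
  have AB: "A \<subseteq> pverts G" "B \<subseteq> pverts G" "A \<inter> B = {}"
    using S(1) by (auto simp: S_eq stable_set_pendant_graph dest: stable_set_subset)
  then have "finite A" "finite B"
    using assms by (auto intro: finite_subset)
  then have "card S = card (A \<union> B)"
    using AB by (simp add: S_eq card_Inl_Inr card_Un_disjoint)
  also have "\<dots> \<le> card (pverts G)"
    using AB assms by (intro card_mono) auto
  finally show "stability_number (pendant_graph G) \<le> card (pverts G)"
    using S(2) by simp
qed

lemma num_stable_sets_pendant_graph:
  assumes fin: "finite (pverts G)" and k: "k \<le> card (pverts G)"
  shows "num_stable_sets (pendant_graph G) k =
    (\<Sum>A | stable_set G A. (card (pverts G) - card A) choose (card (pverts G) - k))"
proof -
  define V where "V = pverts G"
  define n where "n = card V"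
  \<comment> \<open>\<open>C\<close> holds the vertices outside \<open>A\<close> whose pendant is
    left out. Counting omitted rather than chosen pendants makes the lower index
    \<open>n - k\<close> independent of \<open>A\<close>.\<close>
  define P where "P = (SIGMA A:{A. stable_set G A}. {C. C \<subseteq> V - A \<and> card C = n - k})"
  define f :: "'a set \<times> 'a set \<Rightarrow> ('a + 'a) set"
    where "f = (\<lambda>(A, C). Inl ` A \<union> Inr ` (V - A - C))"
  define g :: "('a + 'a) set \<Rightarrow> 'a set \<times> 'a set"
    where "g S = (Inl -` S, V - Inl -` S - Inr -` S)" for S
  have finV: "finite V"
    using fin by (simp add: V_def)
  have card_diff: "card (V - A - C) = n - card A - card C"
    if "A \<subseteq> V" "C \<subseteq> V - A" for A C
    using that finV finite_subset[of _ V]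
    by (auto simp: n_def card_Diff_subset finite_subset[of C "V - A"] finite_subset[of A V])
  have "bij_betw f P {S. stable_set (pendant_graph G) S \<and> card S = k}"
  proof (rule bij_betw_byWitness[where f' = g])
    show "\<forall>p\<in>P. g (f p) = p"
      by (auto simp: P_def f_def g_def vimage_Inl_Inr simp del: vimage_Un)
    show "f ` P \<subseteq> {S. stable_set (pendant_graph G) S \<and> card S = k}"
    proof clarify
      fix A C assume "(A, C) \<in> P"
      then have AC: "stable_set G A" "A \<subseteq> V" "C \<subseteq> V - A" "card C = n - k"
        by (auto simp: P_def V_def dest: stable_set_subset)
      have finA: "finite A" and "finite C"
        using AC finV by (auto intro: finite_subset)
      \<comment> \<open>This bound and the next keep the truncated subtractions exact in
        \<open>card A + (n - card A - (n - k)) = k\<close>.\<close>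
      have "card C \<le> n - card A"
        using AC finV finA card_mono[of "V - A" C] by (simp add: card_Diff_subset n_def)
      moreover have "card A \<le> n"
        using AC finV by (simp add: n_def card_mono)
      ultimately have "card (f (A, C)) = k"
        using AC finA finV k[folded V_def, folded n_def]
        by (simp add: f_def card_Inl_Inr card_diff)
      moreover have "stable_set (pendant_graph G) (f (A, C))"
        using AC by (auto simp: f_def stable_set_pendant_graph V_def)
      ultimately show "stable_set (pendant_graph G) (f (A, C)) \<and> card (f (A, C)) = k"
        by simp
    qed
    have decomp: "stable_set G (Inl -` S) \<and> Inr -` S \<subseteq> V \<and> Inl -` S \<inter> Inr -` S = {}"
      if "stable_set (pendant_graph G) S" for S :: "('a + 'a) set"
      using that stable_set_pendant_graph[of G "Inl -` S" "Inr -` S"]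
      by (simp only: Inl_Inr_vimage[symmetric] V_def)
    show "\<forall>S\<in>{S. stable_set (pendant_graph G) S \<and> card S = k}. f (g S) = S"
    proof clarify
      fix S :: "('a + 'a) set" assume "stable_set (pendant_graph G) S"
      \<comment> \<open>Complementing twice within the vertices outside \<open>Inl -\<close>
        S\<open>returns\<close>Inr -\<open>S\<close>, which lies there by
        \<open>decomp\<close>.\<close>
      then have "V - Inl -` S - (V - Inl -` S - Inr -` S) = Inr -` S"
        using decomp by blast
      then show "f (g S) = S"
        by (simp only: f_def g_def prod.case Inl_Inr_vimage[symmetric])
    qed
    show "g ` {S. stable_set (pendant_graph G) S \<and> card S = k} \<subseteq> P"
    proof (rule image_subsetI)
      fix S :: "('a + 'a) set"
      assume "S \<in> {S. stable_set (pendant_graph G) S \<and> card S = k}"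
      then have S: "stable_set (pendant_graph G) S" "card S = k"
        by auto
      define A where "A = Inl -` S"
      define B where "B = Inr -` S"
      have AB: "stable_set G A" "A \<subseteq> V" "B \<subseteq> V - A"
        using decomp[OF S(1)] by (auto simp: A_def B_def V_def dest: stable_set_subset)
      then have "finite A" "finite B"
        using finV by (auto intro: finite_subset)
      then have "card S = card A + card B"
        using card_Inl_Inr[of A B] by (simp only: A_def B_def Inl_Inr_vimage[symmetric])
      then have "card (V - A - B) = n - card S"
        using AB by (simp add: card_diff)
      then show "g S \<in> P"
        using AB by (auto simp: P_def g_def A_def B_def S(2))
    qed
  qed
  then have "num_stable_sets (pendant_graph G) k = card P"
    unfolding num_stable_sets_def by (simp add: bij_betw_same_card)
  also have "\<dots> = (\<Sum>A | stable_set G A. card {C. C \<subseteq> V - A \<and> card C = n - k})"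
    unfolding P_def using finite_stable_sets[OF fin] finV
    by (intro card_SigmaI) auto
  also have "\<dots> = (\<Sum>A | stable_set G A. (n - card A) choose (n - k))"
  proof (rule sum.cong)
    fix A assume "A \<in> {A. stable_set G A}"
    then have "A \<subseteq> V"
      by (simp add: V_def stable_set_subset)
    then have "card (V - A) = n - card A"
      using finV finite_subset[of A V] by (simp add: card_Diff_subset n_def)
    then show "card {C. C \<subseteq> V - A \<and> card C = n - k} = (n - card A) choose (n - k)"
      using n_subsets[of "V - A" "n - k"] finV by simp
  qed simp
  finally show ?thesis
    by (simp add: n_def V_def)
qed

section \<open>Monotonicity of the coefficient sums\<close>

text \<open>With \<open>q = n - Suc i\<close> one has \<open>n - i = Suc q\<close>, so raising
  \<open>i\<close> lowers the binomial index; the hypothesis on \<open>c A\<close> turns into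
  \<open>n - c A \<le> 2 * q + 1\<close>, and each summand grows.\<close>

lemma binomial_sum_mono:
  fixes c :: "'b \<Rightarrow> nat"
  assumes "i < n" "\<And>A. A \<in> F \<Longrightarrow> 2 * i + 1 \<le> n + c A"
  shows "(\<Sum>A\<in>F. (n - c A) choose (n - i)) \<le> (\<Sum>A\<in>F. (n - c A) choose (n - Suc i))"
proof (rule sum_mono)
  fix A assume "A \<in> F"
  then have "n - c A \<le> 2 * (n - Suc i) + 1"
    using assms(1) assms(2)[of A] by linarith
  then show "(n - c A) choose (n - i) \<le> (n - c A) choose (n - Suc i)"
    using binomial_Suc_le[of "n - c A" "n - Suc i"] assms(1)
    by (metis Suc_diff_Suc)
qed

lemma binomial_sum_antimono:
  fixes c :: "'b \<Rightarrow> nat"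
  assumes "i < n" "\<And>A. A \<in> F \<Longrightarrow> c A \<le> n \<and> n + c A \<le> 2 * i + 1"
  shows "(\<Sum>A\<in>F. (n - c A) choose (n - Suc i)) \<le> (\<Sum>A\<in>F. (n - c A) choose (n - i))"
proof (rule sum_mono)
  fix A assume "A \<in> F"
  then have "2 * (n - Suc i) + 1 \<le> n - c A"
    using assms(1) assms(2)[of A] by linarith
  then show "(n - c A) choose (n - Suc i) \<le> (n - c A) choose (n - i)"
    using binomial_le_Suc[of "n - Suc i" "n - c A"] assms(1)
    by (metis Suc_diff_Suc)
qed

theorem theorem3:
  fixes G :: "'a pair_pre_digraph" and n :: nat
  assumes "pair_graph G"
    and "card (pverts G) = n"
    and "stability_number G \<le> 3"
  shows "unimodal_poly (independence_poly (pendant_graph G)) \<and>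
    (\<exists>k. poly_mode (independence_poly (pendant_graph G)) k \<and>
         (n + 1) div 2 \<le> k \<and> k \<le> (n + 1) div 2 + 1) \<and>
    ((stability_number G = 2 \<and> odd n) \<or> stability_number G = 1 \<longrightarrow>
      poly_mode (independence_poly (pendant_graph G)) ((n + 1) div 2))"
proof -
  interpret pair_graph G by fact
  have fin: "finite (pverts G)"
    by (rule pair_finite_verts)
  define p where "p = independence_poly (pendant_graph G)"
  define m where "m = (n + 1) div 2"
  define t where "t i = (\<Sum>A | stable_set G A. (n - card A) choose (n - i))" for i
  have card_le: "card A \<le> n" "card A \<le> stability_number G" if "stable_set G A" for A
    using that assms(2) fin card_mono[OF fin stable_set_subset[OF that]]
    by (auto intro: card_le_stability_number)
  have coeff_p: "coeff p i = int (t i)" if "i \<le> n" for i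
    using that assms(2) fin
    by (simp add: p_def t_def coeff_independence_poly stability_number_pendant_graph
        num_stable_sets_pendant_graph)
  have "degree p = n"
    using fin assms(2) stability_number_pendant_graph[OF fin]
    by (simp add: p_def degree_independence_poly pendant_graph_def)
  then have mode_iff: "poly_mode p k \<longleftrightarrow>
      k \<le> n \<and> (\<forall>i<k. t i \<le> t (Suc i)) \<and> (\<forall>i\<in>{k..<n}. t (Suc i) \<le> t i)" for k
    by (auto simp: poly_mode_def is_mode_def coeff_p)
  have m: "m \<le> n" "2 * m \<le> n + 1" "n \<le> 2 * m"
    by (auto simp: m_def)
  \<comment> \<open>Here \<open>2 * i + 1 \<le> 2 * m - 1 \<le> n\<close>, so even the summand of
    the empty set increases.\<close>
  have inc: "t i \<le> t (Suc i)" if "i < m" for i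
    unfolding t_def using that m by (intro binomial_sum_mono) auto
  \<comment> \<open>The summands that start to decrease last are those of maximum stable
    sets.\<close>
  have dec: "t (Suc i) \<le> t i" if "i < n" "n + stability_number G \<le> 2 * i + 1" for i
    unfolding t_def
  proof (rule binomial_sum_antimono)
    show "card A \<le> n \<and> n + card A \<le> 2 * i + 1" if "A \<in> {A. stable_set G A}" for A
      using that card_le[of A] \<open>n + stability_number G \<le> 2 * i + 1\<close> by auto
  qed fact
  have "\<exists>k. poly_mode p k \<and> m \<le> k \<and> k \<le> m + 1"
  \<comment> \<open>From \<open>i = m + 1\<close> on, \<open>2 * i + 1 \<ge> n + 3\<close>, so
    \<open>dec\<close> applies. Only the comparison at \<open>m\<close> is open, and it decides
    between the modes \<open>m\<close> and \<open>m + 1\<close>.\<close>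
  proof (cases "m < n \<and> t m \<le> t (Suc m)")
    case True
    then have "poly_mode p (m + 1)"
      using m assms(3) by (auto simp: mode_iff less_Suc_eq intro!: inc dec)
    then show ?thesis
      by auto
  next
    case False
    have "t (Suc i) \<le> t i" if "m \<le> i" "i < n" for i
      using False that m assms(3) by (cases "i = m") (auto intro!: dec)
    then have "poly_mode p m"
      using m by (auto simp: mode_iff intro: inc)
    then show ?thesis
      by auto
  qed
  moreover have "poly_mode p m"
    if "(stability_number G = 2 \<and> odd n) \<or> stability_number G = 1"
  proof -
    \<comment> \<open>For odd \<open>n\<close>, \<open>2 * m + 1 = n + 2\<close> leaves room for
      stability number 2; for any \<open>n\<close>, \<open>2 * m + 1 \<ge> n + 1\<close> suffices
      for 1. Thus \<open>dec\<close> already applies at \<open>m\<close>.\<close>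
    have "n + stability_number G \<le> 2 * m + 1"
      using that by (auto simp: m_def elim!: oddE)
    then show ?thesis
      using m by (auto simp: mode_iff intro!: inc dec)
  qed
  ultimately show ?thesis
    unfolding p_def m_def unimodal_poly_def unimodal_def poly_mode_def by blast
qed

end
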